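(* For every integer $n \ge 4$, the hypercube $Q_n$ satisfies $2n-2 \le \xi(Q_n) \le \binom{n}{2}$.
   Context: Graphs are finite, simple and undirected. The hypercube $Q_n$ is the graph on vertex set $\{0,1\}^n$ in which two vertices are adjacent if and only if they differ in exactly one coordinate. Containment: on a connected graph $G$, $k$ cops are first placed on edges of $G$ (several cops may share an edge), then the robber chooses a vertex. They then alternate turns, cops first, with full information. On the cops' turn each cop stays put or moves to an adjacent edge (an edge sharing an endpoint with her current edge; moving through a vertex occupied by the robber is allowed). On the robber's turn he stays put or moves to an adjacent vertex along an edge not currently occupied by a cop. The cops win (contain the robber) if at some time it is the robber's turn and every edge incident with the robber's vertex is occupied by at least one cop. $G$ is $k$-cop-containable if $k$ cops have a strategy guaranteeing a win, and the containability number $\xi(G)$ is the smallest $k$ such that $G$ is $k$-cop-containable. *)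

theory Defs
  imports Main
begin

text \<open>A graph is a pair of a vertex set and a set of edges, an edge being a two-element set of
  vertices.\<close>

type_synonym 'a ugraph = "'a set \<times> 'a set set"

abbreviation verts :: "'a ugraph \<Rightarrow> 'a set" where "verts \<equiv> fst"
abbreviation edges :: "'a ugraph \<Rightarrow> 'a set set" where "edges \<equiv> snd"

definition finite_simple_graph :: "'a ugraph \<Rightarrow> bool" where
  "finite_simple_graph G \<longleftrightarrow>
     finite (verts G) \<and> (\<forall>e \<in> edges G. e \<subseteq> verts G \<and> card e = 2)"

definition hypercube :: "nat \<Rightarrow> bool list ugraph" where
  "hypercube n =
     ({u. length u = n},
      {{u, v} | u v. length u = n \<and> length v = n \<and> card {i. i < n \<and> u ! i \<noteq> v ! i} = 1})"

text \<open>A placement of \<open>k\<close> cops is a function from cop indices to edges, of which only the values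
  at \<open>i < k\<close> matter.\<close>

type_synonym 'a placement = "nat \<Rightarrow> 'a set"

definition occupied :: "nat \<Rightarrow> 'a placement \<Rightarrow> 'a set set" where
  "occupied k c = c ` {..<k}"

definition cop_move :: "'a ugraph \<Rightarrow> 'a set \<Rightarrow> 'a set \<Rightarrow> bool" where
  "cop_move G e e' \<longleftrightarrow> e' \<in> edges G \<and> (e' = e \<or> e \<inter> e' \<noteq> {})"

definition robber_move :: "'a ugraph \<Rightarrow> nat \<Rightarrow> 'a placement \<Rightarrow> 'a \<Rightarrow> 'a \<Rightarrow> bool" where
  "robber_move G k c x y \<longleftrightarrow> y = x \<or> {x, y} \<in> edges G - occupied k c"

definition contained :: "'a ugraph \<Rightarrow> nat \<Rightarrow> 'a placement \<Rightarrow> 'a \<Rightarrow> bool" where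
  "contained G k c x \<longleftrightarrow> (\<forall>e \<in> edges G. x \<in> e \<longrightarrow> e \<in> occupied k c)"

text \<open>A strategy of the cops maps the list of all robber positions seen so far (oldest first) to
  the placement the cops take next; its value at the empty list is the initial placement. The
  earlier placements of the cops need not be arguments, being determined by the strategy and the
  robber positions. If the robber's positions are \<open>r 0, r 1, \<dots>\<close>, with \<open>r 0\<close> his initial choice,
  then the placements occur in the order
  \<open>cops_at \<sigma> r 0, r 0, cops_at \<sigma> r 1, r 1, cops_at \<sigma> r 2, \<dots>\<close>;
  in particular on the robber's turn in which he leaves \<open>r t\<close> the cops are at
  \<open>cops_at \<sigma> r (Suc t)\<close>.\<close>

type_synonym 'a cop_strategy = "'a list \<Rightarrow> 'a placement"

definition cops_at :: "'a cop_strategy \<Rightarrow> (nat \<Rightarrow> 'a) \<Rightarrow> nat \<Rightarrow> 'a placement" where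
  "cops_at \<sigma> r t = \<sigma> (map r [0..<t])"

definition robber_play :: "'a ugraph \<Rightarrow> nat \<Rightarrow> 'a cop_strategy \<Rightarrow> (nat \<Rightarrow> 'a) \<Rightarrow> bool" where
  "robber_play G k \<sigma> r \<longleftrightarrow>
     r 0 \<in> verts G \<and> (\<forall>t. robber_move G k (cops_at \<sigma> r (Suc t)) (r t) (r (Suc t)))"

text \<open>Plays are infinite: play formally goes on after a containment. This changes nothing, since
  staying put is always a legal move for both sides.\<close>

definition legal_strategy :: "'a ugraph \<Rightarrow> nat \<Rightarrow> 'a cop_strategy \<Rightarrow> bool" where
  "legal_strategy G k \<sigma> \<longleftrightarrow>
     (\<forall>i<k. \<sigma> [] i \<in> edges G) \<and>
     (\<forall>r. robber_play G k \<sigma> r \<longrightarrow>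
        (\<forall>t. \<forall>i<k. cop_move G (cops_at \<sigma> r t i) (cops_at \<sigma> r (Suc t) i)))"

definition winning_strategy :: "'a ugraph \<Rightarrow> nat \<Rightarrow> 'a cop_strategy \<Rightarrow> bool" where
  "winning_strategy G k \<sigma> \<longleftrightarrow>
     legal_strategy G k \<sigma> \<and>
     (\<forall>r. robber_play G k \<sigma> r \<longrightarrow> (\<exists>t. contained G k (cops_at \<sigma> r (Suc t)) (r t)))"

definition cop_containable :: "'a ugraph \<Rightarrow> nat \<Rightarrow> bool" where
  "cop_containable G k \<longleftrightarrow> (\<exists>\<sigma>. winning_strategy G k \<sigma>)"

definition containability_number :: "'a ugraph \<Rightarrow> nat" where
  "containability_number G = (LEAST k. cop_containable G k)"

text \<open>The minimum exists for every finite graph, since one cop on each edge suffices.\<close>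

lemma cop_containable_card_edges:
  assumes "finite (edges G)"
  shows "cop_containable G (card (edges G))"
proof -
  obtain f where f: "bij_betw f {0..<card (edges G)} (edges G)"
    using ex_bij_betw_nat_finite[OF assms] by blast
  have img: "f ` {..<card (edges G)} = edges G"
    using f by (simp add: bij_betw_def atLeast0LessThan)
  have "winning_strategy G (card (edges G)) (\<lambda>_. f)"
    using img by (auto simp: winning_strategy_def legal_strategy_def cops_at_def cop_move_def
        contained_def occupied_def)
  then show ?thesis
    by (auto simp: cop_containable_def)
qed

lemma finite_simple_graph_finite_edges:
  assumes "finite_simple_graph G"
  shows "finite (edges G)"
proof -
  have "edges G \<subseteq> Pow (verts G)" "finite (verts G)"
    using assms by (auto simp: finite_simple_graph_def)
  then show ?thesis
    by (meson finite_Pow_iff finite_subset)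
qed

lemma finite_simple_graph_hypercube: "finite_simple_graph (hypercube n)"
proof -
  have "finite {u :: bool list. length u = n}"
    using finite_lists_length_eq[of "UNIV :: bool set" n] by simp
  moreover have "u \<noteq> v" if "card {i. i < n \<and> u ! i \<noteq> v ! i} = 1" for u v :: "bool list"
    using that by auto
  ultimately show ?thesis
    by (auto simp: finite_simple_graph_def hypercube_def card_2_iff)
qed

end

theory Submission imports Defs begin

text \<open>Lower bound: let the robber stand, not contained, at \<open>x\<close>. A cop away from \<open>x\<close> can help to
  contain him next turn on at most two neighbours of \<open>x\<close>, whereas containing him on a neighbour
  reached by a free edge needs at least \<open>n - 1\<close> such cops. Double counting against the cops
  blocking edges at \<open>x\<close> leaves at most two free edges, and \<open>2 * n - 3\<close> cops do not suffice
  in either case.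

  Upper bound: one cop for every pair \<open>{i, j}\<close> of coordinates tries to reach the vertex that
  differs from the robber's in exactly \<open>i\<close> and \<open>j\<close>. She mirrors the robber's moves, or profits from
  them. When he moves in a direction \<open>i\<close> all of whose pairs are in place, these cops block
  every edge at his new vertex but the one he came from; while he dwells on
  that edge the other cops approach unhindered. Once all pairs are in place, the cops choose
  edges towards the robber's neighbours along a tournament without sinks and close in.\<close>

section \<open>The robber's escape\<close>

definition nbrs :: "'a ugraph \<Rightarrow> 'a \<Rightarrow> 'a set" where
  "nbrs G x = {y. {x, y} \<in> edges G}"

definition safe :: "'a ugraph \<Rightarrow> nat \<Rightarrow> 'a placement \<Rightarrow> 'a \<Rightarrow> bool" where
  "safe G k c y \<longleftrightarrow> (\<forall>c'. (\<forall>i<k. cop_move G (c i) (c' i)) \<longrightarrow> \<not> contained G k c' y)"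

text \<open>Against a fixed strategy the robber keeps choosing safe vertices. Safety rules out
  containment after the cops' reply, so \<open>step\<close> applies again, and he is never
  contained.\<close>

lemma not_containable_if_robber_evades:
  assumes start: "\<And>c. \<forall>i<k. c i \<in> edges G \<Longrightarrow> \<exists>y \<in> verts G. safe G k c y"
    and step: "\<And>c x. \<lbrakk>\<forall>i<k. c i \<in> edges G; x \<in> verts G; \<not> contained G k c x\<rbrakk>
      \<Longrightarrow> \<exists>y \<in> verts G. robber_move G k c x y \<and> safe G k c y"
  shows "\<not> cop_containable G k"
proof
  assume "cop_containable G k"
  then obtain \<sigma> where ws: "winning_strategy G k \<sigma>"
    by (auto simp: cop_containable_def)
  have init: "\<forall>i<k. \<sigma> [] i \<in> edges G"
    using ws by (simp add: winning_strategy_def legal_strategy_def)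
  obtain y0 where y0: "y0 \<in> verts G" "safe G k (\<sigma> []) y0"
    using start[OF init] by blast
  define good where "good c x y \<longleftrightarrow> y \<in> verts G \<and> robber_move G k c x y \<and> safe G k c y" for c x y
  \<comment> \<open>Staying put as default makes the play legal unconditionally. This matters
    because the cops' moves are known to be legal only against legal play, and \<open>inv\<close>
    relies on them.\<close>
  define nxt where "nxt c x = (if \<exists>y. good c x y then SOME y. good c x y else x)" for c x
  define hist where "hist = rec_nat [y0] (\<lambda>_ h. h @ [nxt (\<sigma> h) (last h)])"
  define r where "r t = last (hist t)" for t
  have hist_0: "hist 0 = [y0]" and hist_Suc: "hist (Suc t) = hist t @ [nxt (\<sigma> (hist t)) (r t)]" for t
    by (simp_all add: hist_def r_def)
  have r_0: "r 0 = y0" by (simp add: r_def hist_0)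
  have r_Suc: "r (Suc t) = nxt (\<sigma> (hist t)) (r t)" for t
    using hist_Suc[of t] by (simp add: r_def)
  have map_r: "map r [0..<Suc t] = hist t" for t
    by (induction t) (simp_all add: r_0 hist_0 hist_Suc r_Suc)
  have c_Suc: "cops_at \<sigma> r (Suc t) = \<sigma> (hist t)" for t
    by (simp only: cops_at_def map_r)
  have good_nxt: "good c x (nxt c x)" if "\<exists>y. good c x y" for c x
    using someI_ex[OF that] that by (simp add: nxt_def)
  have play: "robber_play G k \<sigma> r"
    unfolding robber_play_def
  proof (intro conjI allI)
    show "r 0 \<in> verts G" by (simp add: r_0 y0)
    show "robber_move G k (cops_at \<sigma> r (Suc t)) (r t) (r (Suc t))" for t
      using good_nxt[of "\<sigma> (hist t)" "r t"]
      by (cases "\<exists>y. good (\<sigma> (hist t)) (r t) y") (auto simp: c_Suc r_Suc good_def nxt_def robber_move_def)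
  qed
  have legal: "\<forall>i<k. cop_move G (cops_at \<sigma> r t i) (cops_at \<sigma> r (Suc t) i)" for t
    using ws play by (simp add: winning_strategy_def legal_strategy_def)
  have inv: "r t \<in> verts G \<and> safe G k (cops_at \<sigma> r t) (r t)" for t
  proof (induction t)
    case 0
    then show ?case using y0 by (simp add: r_0 cops_at_def)
  next
    case (Suc t)
    have "\<not> contained G k (cops_at \<sigma> r (Suc t)) (r t)"
      using Suc legal[of t] unfolding safe_def by blast
    moreover have "\<forall>i<k. cops_at \<sigma> r (Suc t) i \<in> edges G"
      using legal[of t] by (auto simp: cop_move_def)
    ultimately have "\<exists>y. good (cops_at \<sigma> r (Suc t)) (r t) y"
      using step[of "cops_at \<sigma> r (Suc t)" "r t"] Suc by (auto simp: good_def)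
    then show ?case
      using good_nxt[of "cops_at \<sigma> r (Suc t)" "r t"] by (simp add: r_Suc good_def c_Suc)
  qed
  obtain t where "contained G k (cops_at \<sigma> r (Suc t)) (r t)"
    using ws play by (auto simp: winning_strategy_def)
  then show False
    using inv[of t] legal[of t] unfolding safe_def by blast
qed

section \<open>Lower bound by double counting\<close>

text \<open>This is what the lower bound takes from the hypercube. The colouring gives every edge
  one end in the colour class of the robber's vertex, and that end represents the cop in the
  count.\<close>

locale regular_bipartite_codegree_two =
  fixes G :: "'a ugraph" and n :: nat and col :: "'a \<Rightarrow> bool"
  assumes simple: "finite_simple_graph G"
    and deg: "x \<in> verts G \<Longrightarrow> card (nbrs G x) = n"
    and col: "{x, y} \<in> edges G \<Longrightarrow> col x \<noteq> col y"
    and codeg: "\<lbrakk>x \<in> verts G; y \<in> verts G; x \<noteq> y\<rbrakk> \<Longrightarrow> card (nbrs G x \<inter> nbrs G y) \<le> 2"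
begin

lemma edge_vertsD: "{x, y} \<in> edges G \<Longrightarrow> x \<in> verts G \<and> y \<in> verts G"
  using simple by (auto simp: finite_simple_graph_def)

lemma finite_nbrs [simp]: "finite (nbrs G x)"
  by (rule finite_subset[of _ "verts G"]) (use simple edge_vertsD in \<open>auto simp: nbrs_def finite_simple_graph_def\<close>)

lemma edgeE:
  assumes "e \<in> edges G"
  obtains u v where "e = {u, v}" "col u = b" "col v \<noteq> b" "u \<in> verts G" "v \<in> verts G"
proof -
  obtain u v where e: "e = {u, v}"
    using simple assms by (auto simp: finite_simple_graph_def card_2_iff)
  then have "col u \<noteq> col v" "u \<in> verts G" "v \<in> verts G"
    using col edge_vertsD assms by blast+
  then show ?thesis
    using that[of u v] that[of v u] e by (cases "col u = b") (auto simp: insert_commute)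
qed

text \<open>Edges that meet share their ends of colour \<open>b\<close> or their other ends. The
  first case gives \<open>u = z\<close>, the second \<open>v = y\<close>; either way
  \<open>u\<close> is adjacent to \<open>y\<close>.\<close>

lemma serving_cop:
  assumes e: "e \<in> edges G" and m: "cop_move G e {y, z}" and c: "col y \<noteq> b" "e = {u, v}" "col u = b" "col v \<noteq> b"
  shows "u \<in> nbrs G y" and "u = z \<or> v = y"
proof -
  have yz: "{y, z} \<in> edges G" using m by (simp add: cop_move_def)
  have cz: "col z = b" using col[OF yz] c by auto
  have "e = {y, z} \<or> e \<inter> {y, z} \<noteq> {}" using m by (auto simp: cop_move_def)
  then show *: "u = z \<or> v = y"
    using c cz by (auto simp: doubleton_eq_iff)
  then show "u \<in> nbrs G y"
    using yz e c by (auto simp: nbrs_def insert_commute)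
qed

text \<open>Otherwise \<open>n \<le> card F + card A\<close> and
  \<open>card F * (n - 1) \<le> 2 * card B\<close>, where \<open>F\<close> are the free neighbours,
  \<open>A\<close> the cops on edges at \<open>x\<close> and \<open>B\<close> the others. As there
  are at most \<open>2 * n - 3\<close> cops, \<open>card F * (n - 3) \<le> 2 * (n - 3)\<close>
  follows, hence \<open>card F \<le> 2\<close>; the two remaining values are excluded
  separately.\<close>

lemma escape:
  assumes n: "n \<ge> 4" and k: "k \<le> 2 * n - 3" and cE: "\<forall>i<k. c i \<in> edges G" and x: "x \<in> verts G"
    and nc: "\<not> contained G k c x"
  shows "\<exists>y \<in> verts G. robber_move G k c x y \<and> safe G k c y"
proof (rule ccontr)
  assume contra: "\<not> ?thesis"
  define F where "F = {y \<in> nbrs G x. {x, y} \<notin> occupied k c}"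
  define A where "A = {i. i < k \<and> x \<in> c i}"
  define B where "B = {i. i < k \<and> x \<notin> c i}"
  define base where "base i = (SOME u. \<exists>v. c i = {u, v} \<and> col u = col x \<and> col v \<noteq> col x \<and> u \<in> verts G)" for i
  have base: "\<exists>v. c i = {base i, v} \<and> col (base i) = col x \<and> col v \<noteq> col x \<and> base i \<in> verts G" if "i < k" for i
  proof -
    have "\<exists>u v. c i = {u, v} \<and> col u = col x \<and> col v \<noteq> col x \<and> u \<in> verts G"
      using cE that edgeE[of "c i" "col x"] by metis
    then show ?thesis unfolding base_def by (rule someI_ex)
  qed
  define S where "S y = {i \<in> B. base i \<in> nbrs G y}" for y
  have [simp]: "finite A" "finite B" "finite F" "finite (S y)" for y
    by (auto simp: A_def B_def F_def S_def)
  have AB: "card A + card B = k"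
  proof -
    have "A \<union> B = {..<k}" "A \<inter> B = {}" by (auto simp: A_def B_def)
    then show ?thesis using card_Un_disjoint[of A B] by simp
  qed
  have Fne: "F \<noteq> {}"
  proof -
    obtain e where e: "e \<in> edges G" "x \<in> e" "e \<notin> occupied k c"
      using nc by (auto simp: contained_def)
    obtain u v where "e = {u, v}" using edgeE[OF e(1)] by metis
    then obtain y where "e = {x, y}" using e(2) by auto
    then have "y \<in> F" using e by (simp add: F_def nbrs_def)
    then show ?thesis by blast
  qed
  have Fdeg: "n \<le> card F + card A"
  proof -
    have "\<forall>y \<in> nbrs G x - F. \<exists>i. i \<in> A \<and> c i = {x, y}"
      by (auto simp: F_def A_def occupied_def)
    then obtain f where f: "\<And>y. y \<in> nbrs G x - F \<Longrightarrow> f y \<in> A \<and> c (f y) = {x, y}"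
      by metis
    have "inj_on f (nbrs G x - F)"
      by (rule inj_onI) (metis f doubleton_eq_iff)
    then have "card (nbrs G x - F) \<le> card A"
      by (rule card_inj_on_le) (use f in auto)
    moreover have "card (nbrs G x - F) = n - card F"
      using card_Diff_subset[of F "nbrs G x"] deg[OF x] by (auto simp: F_def)
    ultimately show ?thesis by simp
  qed
  \<comment> \<open>The edge \<open>{y, x}\<close> is left out, since a cop of \<open>A\<close> may
    close it. Every other edge at \<open>y\<close> needs its own cop, and she is not in
    \<open>A\<close>: from an edge through \<open>x\<close> she could reach \<open>{y, z}\<close>
    only if hers were \<open>{x, y}\<close>, which is free.\<close>
  have serve: "\<exists>f. inj_on f (nbrs G y - {x}) \<and> f ` (nbrs G y - {x}) \<subseteq> S y \<and>
      (\<forall>z \<in> nbrs G y - {x}. base (f z) \<noteq> z \<longrightarrow> c (f z) = {base (f z), y})" if y: "y \<in> F" for y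
  proof -
    have xy: "{x, y} \<in> edges G" and free: "{x, y} \<notin> occupied k c"
      using y by (auto simp: F_def nbrs_def)
    then have yv: "y \<in> verts G" and cy: "col y \<noteq> col x"
      using edge_vertsD col[OF xy] by auto
    have "robber_move G k c x y"
      using xy free by (simp add: robber_move_def)
    then obtain c' where c': "\<And>i. i < k \<Longrightarrow> cop_move G (c i) (c' i)" "contained G k c' y"
      using contra yv unfolding safe_def by blast
    have "\<exists>i. i < k \<and> c' i = {y, z}" if "z \<in> nbrs G y - {x}" for z
    proof -
      have "{y, z} \<in> c' ` {..<k}"
        using c'(2) that by (simp add: contained_def nbrs_def occupied_def)
      then show ?thesis by (metis imageE lessThan_iff)
    qed
    then obtain f where f: "\<And>z. z \<in> nbrs G y - {x} \<Longrightarrow> f z < k \<and> c' (f z) = {y, z}"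
      by metis
    have inj: "inj_on f (nbrs G y - {x})"
      by (rule inj_onI) (metis f doubleton_eq_iff)
    have main: "f z \<in> S y \<and> (base (f z) \<noteq> z \<longrightarrow> c (f z) = {base (f z), y})" if z: "z \<in> nbrs G y - {x}" for z
    proof -
      have i: "f z < k" and m: "cop_move G (c (f z)) {y, z}"
        using f[OF z] c'(1) by metis+
      obtain v where v: "c (f z) = {base (f z), v}" "col (base (f z)) = col x" "col v \<noteq> col x"
        using base[OF i] by blast
      have e: "c (f z) \<in> edges G" using cE i by blast
      note s = serving_cop[OF e m cy v]
      have "x \<notin> c (f z)"
      proof
        assume "x \<in> c (f z)"
        then have xb: "base (f z) = x" using v by auto
        moreover have "z \<noteq> x" using z by simp
        ultimately have "v = y" using s(2) by simp
        then have "{x, y} = c (f z)" using v(1) xb by simp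
        then show False using free i unfolding occupied_def by blast
      qed
      then show ?thesis using s i v by (auto simp: S_def B_def)
    qed
    then show ?thesis using inj by blast
  qed
  have Scard: "n - 1 \<le> card (S y)" if y: "y \<in> F" for y
  proof -
    obtain f where f: "inj_on f (nbrs G y - {x})" "f ` (nbrs G y - {x}) \<subseteq> S y"
      using serve[OF y] by blast
    have "x \<in> nbrs G y" "y \<in> verts G" using y edge_vertsD by (auto simp: F_def nbrs_def insert_commute)
    then have "card (nbrs G y - {x}) = n - 1" using deg by simp
    then show ?thesis using card_inj_on_le[OF f] by simp
  qed
  have basex: "base i \<in> verts G \<and> base i \<noteq> x" if "i \<in> B" for i
    using base[of i] that by (auto simp: B_def)
  \<comment> \<open>Count the pairs of \<open>y \<in> F\<close> and \<open>i \<in> B\<close> with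
    \<open>base i\<close> adjacent to \<open>y\<close>: at least \<open>n - 1\<close> for each
    \<open>y\<close>, at most two for each \<open>i\<close>, since such \<open>y\<close> are common
    neighbours of \<open>x\<close> and \<open>base i\<close>.\<close>
  have "card F * (n - 1) \<le> (\<Sum>y\<in>F. card (S y))"
    using sum_mono[of F "\<lambda>_. n - 1" "\<lambda>y. card (S y)"] Scard by simp
  also have "\<dots> = (\<Sum>y\<in>F. \<Sum>i\<in>B. if base i \<in> nbrs G y then 1 else 0)"
    by (simp add: S_def sum.If_cases Int_def)
  also have "\<dots> = (\<Sum>i\<in>B. \<Sum>y\<in>F. if base i \<in> nbrs G y then 1 else 0)"
    by (rule sum.swap)
  also have "\<dots> = (\<Sum>i\<in>B. card {y \<in> F. base i \<in> nbrs G y})"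
    by (simp add: sum.If_cases Int_def)
  also have "\<dots> \<le> (\<Sum>i\<in>B. 2)"
  proof (rule sum_mono)
    fix i assume i: "i \<in> B"
    have "card {y \<in> F. base i \<in> nbrs G y} \<le> card (nbrs G x \<inter> nbrs G (base i))"
    proof (rule card_mono)
      show "{y \<in> F. base i \<in> nbrs G y} \<subseteq> nbrs G x \<inter> nbrs G (base i)"
        by (auto simp: F_def nbrs_def insert_commute)
    qed simp
    also have "\<dots> \<le> 2" using codeg[of x "base i"] basex[OF i] x by auto
    finally show "card {y \<in> F. base i \<in> nbrs G y} \<le> 2" .
  qed
  finally have count: "card F * (n - 1) \<le> 2 * card B" by simp
  have "card F \<le> 2"
  proof (rule ccontr)
    assume "\<not> ?thesis"
    then have "3 \<le> card F" by simp
    then obtain f where f: "card F = f + 3" using le_Suc_ex add.commute by metis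
    obtain m where m: "n = m + 4" using le_Suc_ex[OF n] add.commute by metis
    have "(f + 3) * (m + 3) \<le> 2 * card B" using count f m by (simp add: numeral_eq_Suc)
    also have "card B \<le> m + 4 + f"
    proof -
      have "card B + card A \<le> 2 * m + 5" using AB k m by simp
      moreover have "m + 4 \<le> f + 3 + card A" using Fdeg f m by simp
      ultimately show ?thesis by linarith
    qed
    finally have "(f + 3) * (m + 3) \<le> 2 * (m + 4 + f)" by simp
    then show False by (simp add: algebra_simps)
  qed
  moreover have "card F \<noteq> 0" using Fne by simp
  ultimately consider "card F = 1" | "card F = 2" by linarith
  then show False
  proof cases
    case 1
    then obtain y where "y \<in> F" by fastforce
    then have "n - 1 \<le> card B" using Scard[of y] card_mono[of B "S y"] by (auto simp: S_def)
    then show False using 1 Fdeg AB k n by linarith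
  next
    case 2
    then obtain y1 y2 where y: "F = {y1, y2}" "y1 \<noteq> y2" by (auto simp: card_2_iff)
    \<comment> \<open>Now \<open>B\<close> is so small that all its cops must serve both
      \<open>y1\<close> and \<open>y2\<close>. Their bases are common neighbours of
      \<open>y1\<close> and \<open>y2\<close> other than \<open>x\<close>, hence a single vertex
      \<open>w\<close>.\<close>
    have Bn: "card B \<le> n - 1" using 2 Fdeg AB k n by linarith
    have SB: "S y = B" if "y \<in> F" for y
      by (rule card_subset_eq) (use Scard[OF that] Bn card_mono[of B "S y"] in \<open>auto simp: S_def\<close>)
    have yv: "y1 \<in> verts G" "y2 \<in> verts G"
      using y edge_vertsD by (auto simp: F_def nbrs_def)
    have xn: "x \<in> nbrs G y" if "y \<in> F" for y
      using that by (auto simp: F_def nbrs_def insert_commute)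
    have "card (nbrs G y1 \<inter> nbrs G y2 - {x}) \<le> 1"
      using codeg[OF yv y(2)] xn y by (simp add: card_Diff_singleton_if)
    moreover have "base ` B \<subseteq> nbrs G y1 \<inter> nbrs G y2 - {x}"
      using SB y basex by (auto simp: S_def)
    ultimately have "card (base ` B) \<le> 1"
      by (meson card_mono finite_Diff finite_Int finite_nbrs le_trans)
    then obtain w where w: "\<And>i. i \<in> B \<Longrightarrow> base i = w"
      by (metis (full_types) \<open>finite B\<close> finite_imageI card_le_Suc0_iff_eq One_nat_def imageI)
    \<comment> \<open>For \<open>z \<noteq> w\<close> the cop who closes \<open>{y, z}\<close> has
      base \<open>w \<noteq> z\<close>, so she must already be on \<open>{w, y}\<close>. This holds
      for at least \<open>n - 2\<close> cops at each of \<open>y1\<close> and \<open>y2\<close>,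
      together more than \<open>card B\<close>.\<close>
    have many: "n - 2 \<le> card {i \<in> B. c i = {w, y}}" if yF: "y \<in> F" for y
    proof -
      obtain f where f: "inj_on f (nbrs G y - {x})" "f ` (nbrs G y - {x}) \<subseteq> S y"
        "\<forall>z \<in> nbrs G y - {x}. base (f z) \<noteq> z \<longrightarrow> c (f z) = {base (f z), y}"
        using serve[OF yF] by blast
      have "f ` (nbrs G y - {x} - {w}) \<subseteq> {i \<in> B. c i = {w, y}}"
      proof clarsimp
        fix z assume z: "z \<in> nbrs G y" "z \<noteq> x" "z \<noteq> w"
        then have "f z \<in> B" using f(2) SB[OF yF] by blast
        moreover have "base (f z) = w" using w calculation by simp
        moreover have "base (f z) \<noteq> z \<longrightarrow> c (f z) = {base (f z), y}" using f(3) z(1,2) by simp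
        ultimately show "f z \<in> B \<and> c (f z) = {w, y}" using z(3) by simp
      qed
      moreover have "inj_on f (nbrs G y - {x} - {w})"
        using f(1) by (rule inj_on_subset) auto
      ultimately have "card (nbrs G y - {x} - {w}) \<le> card {i \<in> B. c i = {w, y}}"
        by (intro card_inj_on_le) simp_all
      moreover have "card (nbrs G y) = n" using deg yv yF y by auto
      then have "n - 2 \<le> card (nbrs G y - {x} - {w})"
        by (auto simp: card_Diff_singleton_if)
      ultimately show ?thesis by simp
    qed
    have "card {i \<in> B. c i = {w, y1}} + card {i \<in> B. c i = {w, y2}}
        = card ({i \<in> B. c i = {w, y1}} \<union> {i \<in> B. c i = {w, y2}})"
      by (rule card_Un_disjoint[symmetric]) (use y(2) in \<open>auto simp: doubleton_eq_iff\<close>)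
    also have "\<dots> \<le> card B" by (rule card_mono) auto
    finally show False using many[of y1] many[of y2] y Bn n by simp
  qed
qed

text \<open>The edges at two adjacent vertices number \<open>2 * n - 1\<close>, more than there are
  cops. So at one of the two the robber would not be contained, and \<open>escape\<close> from there
  yields the vertex to start on.\<close>

lemma ex_safe_vertex:
  assumes n: "n \<ge> 4" and k: "k \<le> 2 * n - 3" and cE: "\<forall>i<k. c i \<in> edges G" and ne: "verts G \<noteq> {}"
  shows "\<exists>y \<in> verts G. safe G k c y"
proof -
  obtain x where x: "x \<in> verts G" using ne by blast
  then have "nbrs G x \<noteq> {}" using deg n by force
  then obtain y where xy: "{x, y} \<in> edges G" by (auto simp: nbrs_def)
  have y: "y \<in> verts G" and neq: "x \<noteq> y" using edge_vertsD[OF xy] col[OF xy] by auto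
  have "\<not> (contained G k c x \<and> contained G k c y)"
  proof
    assume con: "contained G k c x \<and> contained G k c y"
    let ?X = "(\<lambda>z. {x, z}) ` nbrs G x" and ?Y = "(\<lambda>z. {y, z}) ` (nbrs G y - {x})"
    have "x \<in> nbrs G y" using xy by (simp add: nbrs_def insert_commute)
    then have "card ?X = n" "card ?Y = n - 1"
      using deg[OF x] deg[OF y] by (subst card_image; simp add: inj_on_def doubleton_eq_iff)+
    moreover have "?X \<inter> ?Y = {}" using neq by (auto simp: doubleton_eq_iff)
    ultimately have "card (?X \<union> ?Y) = n + (n - 1)" by (subst card_Un_disjoint) auto
    moreover have "?X \<union> ?Y \<subseteq> occupied k c"
      using con by (auto simp: contained_def nbrs_def)
    moreover have "card (occupied k c) \<le> k"
      using card_image_le[of "{..<k}" c] by (simp add: occupied_def)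
    ultimately show False
      using card_mono[of "occupied k c" "?X \<union> ?Y"] n k by (simp add: occupied_def)
  qed
  then show ?thesis using escape[OF n k cE] x y by blast
qed

lemma containable_lower_bound:
  assumes n: "n \<ge> 4" and ne: "verts G \<noteq> {}" and con: "cop_containable G k"
  shows "2 * n - 2 \<le> k"
proof (rule ccontr)
  assume "\<not> ?thesis"
  then have k: "k \<le> 2 * n - 3" by simp
  show False
    using not_containable_if_robber_evades[of k G] ex_safe_vertex[OF n k _ ne] escape[OF n k] con by blast
qed

end

section \<open>The cops' pursuit\<close>

definition cop_moves :: "'a ugraph \<Rightarrow> 'p set \<Rightarrow> ('p \<Rightarrow> 'a set) \<Rightarrow> ('p \<Rightarrow> 'a set) \<Rightarrow> bool" where
  "cop_moves G P c c' \<longleftrightarrow> (\<forall>p \<in> P. cop_move G (c p) (c' p))"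

text \<open>Backward induction with the robber to move from \<open>x\<close>; \<open>m\<close>
  bounds the number of further rounds. The cops are indexed by an arbitrary set \<open>P\<close>, so
  that pairs of coordinates can name them.\<close>

primrec wins_within ::
  "'a ugraph \<Rightarrow> 'p set \<Rightarrow> nat \<Rightarrow> ('p \<Rightarrow> 'a set) \<Rightarrow> 'a \<Rightarrow> bool" where
  "wins_within G P 0 c x \<longleftrightarrow> (\<forall>e \<in> edges G. x \<in> e \<longrightarrow> e \<in> c ` P)"
| "wins_within G P (Suc m) c x \<longleftrightarrow> (\<forall>e \<in> edges G. x \<in> e \<longrightarrow> e \<in> c ` P) \<or>
     (\<forall>y. y = x \<or> {x, y} \<in> edges G - c ` P \<longrightarrow> (\<exists>c'. cop_moves G P c c' \<and> wins_within G P m c' y))"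

lemma wins_within_step:
  assumes "m' = Suc m"
    and "\<And>y. y = x \<or> {x, y} \<in> edges G - c ` P \<Longrightarrow> \<exists>c'. cop_moves G P c c' \<and> wins_within G P m c' y"
  shows "wins_within G P m' c x"
  using assms by simp

lemma wins_within_Suc: "wins_within G P m c x \<Longrightarrow> wins_within G P (Suc m) c x"
proof (induction m arbitrary: c x)
  case (Suc m)
  then show ?case
    unfolding wins_within.simps(2)[of G P "Suc m"] by (metis wins_within.simps(2))
qed simp

lemma wins_within_mono: "m \<le> m' \<Longrightarrow> wins_within G P m c x \<Longrightarrow> wins_within G P m' c x"
  by (induction m' rule: dec_induct) (auto simp del: wins_within.simps intro: wins_within_Suc)

text \<open>The strategy replays the history from \<open>c0\<close>, each time choosing a placement
  that still wins within the remaining rounds. When the bound has reached 0, winning is containment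
  itself.\<close>

lemma cop_containable_if_wins_within:
  fixes P :: "'p set"
  assumes "finite P" and c0: "\<And>p. p \<in> P \<Longrightarrow> c0 p \<in> edges G"
    and start: "\<And>x. x \<in> verts G \<Longrightarrow> \<exists>c. cop_moves G P c0 c \<and> wins_within G P m c x"
  shows "cop_containable G (card P)"
proof -
  let ?k = "card P"
  obtain h where h: "bij_betw h {..<?k} P"
    using ex_bij_betw_nat_finite[OF \<open>finite P\<close>] by (auto simp: atLeast0LessThan)
  have hP: "h ` {..<?k} = P" using h by (simp add: bij_betw_def)
  have occ: "occupied ?k (c \<circ> h) = c ` P" for c :: "'p \<Rightarrow> 'a set"
    by (simp only: occupied_def image_comp[symmetric] hP)
  \<comment> \<open>The state pairs the bound that the next reply must meet with the current
    placement. The first reply has the full bound \<open>m\<close>, as it follows the robber's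
    initial choice. Keeping the placement as default makes the replies legal on every
    history.\<close>
  define reply where "reply s y =
    (let Q = \<lambda>c'. cop_moves G P (snd s) c' \<and> wins_within G P (fst s) c' y
     in (fst s - 1, if \<exists>c'. Q c' then SOME c'. Q c' else snd s))" for s y
  define st where "st = foldl reply (m, c0)"
  define \<sigma> where "\<sigma> ys = snd (st ys) \<circ> h" for ys
  have st_Nil: "st [] = (m, c0)" and st_snoc: "st (ys @ [y]) = reply (st ys) y" for ys y
    by (simp_all add: st_def)
  have fst_reply: "fst (reply s y) = fst s - 1" for s y by (simp add: reply_def Let_def)
  have reply: "cop_moves G P (snd s) (snd (reply s y)) \<and> wins_within G P (fst s) (snd (reply s y)) y"
    if "\<exists>c'. cop_moves G P (snd s) c' \<and> wins_within G P (fst s) c' y" for s y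
    using someI_ex[OF that] that by (simp add: reply_def Let_def)
  have idle: "snd (reply s y) = snd s"
    if "\<nexists>c'. cop_moves G P (snd s) c' \<and> wins_within G P (fst s) c' y" for s y
    unfolding reply_def Let_def if_not_P[OF that] by simp
  have edges: "\<forall>p \<in> P. snd (st ys) p \<in> edges G" for ys
  proof (induction ys rule: rev_induct)
    case (snoc y ys)
    then show ?case
      using reply[of "st ys" y] idle[of "st ys" y] unfolding st_snoc cop_moves_def cop_move_def by metis
  qed (simp add: st_Nil c0)
  have moves: "cop_moves G P (snd (st ys)) (snd (st (ys @ [y])))" for ys y
    using reply[of "st ys" y] idle[of "st ys" y] edges[of ys]
    unfolding st_snoc cop_moves_def cop_move_def by metis
  have at: "cops_at \<sigma> r t i = snd (st (map r [0..<t])) (h i)" for r t i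
    by (simp add: cops_at_def \<sigma>_def)
  have legal: "legal_strategy G ?k \<sigma>"
    using edges[of "[]"] moves bij_betwE[OF h]
    by (auto simp: legal_strategy_def at cop_moves_def) (simp add: \<sigma>_def)
  have "\<exists>t. contained G ?k (cops_at \<sigma> r (Suc t)) (r t)" if play: "robber_play G ?k \<sigma> r" for r
  proof (rule ccontr)
    assume not: "\<not> ?thesis"
    define s where "s t = st (map r [0..<t])" for t
    have s_Suc: "s (Suc t) = reply (s t) (r t)" for t by (simp add: s_def st_snoc)
    have fst_s: "fst (s t) = m - t" for t
      by (induction t) (simp_all add: s_Suc fst_reply, simp add: s_def st_Nil)
    have cops: "cops_at \<sigma> r t = snd (s t) \<circ> h" for t
      by (rule ext) (simp add: at s_def)
    have never: "\<not> (\<forall>e \<in> edges G. r t \<in> e \<longrightarrow> e \<in> snd (s (Suc t)) ` P)" for t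
      using not by (simp add: contained_def cops occ)
    have "t \<le> m \<Longrightarrow> wins_within G P (m - t) (snd (s (Suc t))) (r t)" for t
    proof (induction t)
      case 0
      have "r 0 \<in> verts G" using play by (simp add: robber_play_def)
      then show ?case using start[of "r 0"] reply[of "s 0" "r 0"]
        by (simp add: s_Suc fst_s) (simp add: s_def st_Nil)
    next
      case (Suc t)
      then have "wins_within G P (Suc (m - Suc t)) (snd (s (Suc t))) (r t)"
        by (simp add: Suc_diff_Suc del: wins_within.simps)
      moreover have "r (Suc t) = r t \<or> {r t, r (Suc t)} \<in> edges G - snd (s (Suc t)) ` P"
        using play by (simp add: robber_play_def robber_move_def cops occ)
      ultimately have "\<exists>c'. cop_moves G P (snd (s (Suc t))) c' \<and> wins_within G P (m - Suc t) c' (r (Suc t))"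
        using never[of t] by (metis wins_within.simps(2))
      then show ?case
        using reply[of "s (Suc t)" "r (Suc t)"] by (simp add: s_Suc[of "Suc t"] fst_s)
    qed
    from this[of m] show False using never[of m] by simp
  qed
  then show ?thesis
    using legal by (auto simp: cop_containable_def winning_strategy_def)
qed

section \<open>Hypercube vertices as flipped coordinate sets\<close>

definition flip :: "bool list \<Rightarrow> nat set \<Rightarrow> bool list" where
  "flip x A = map (\<lambda>i. x ! i \<noteq> (i \<in> A)) [0..<length x]"

lemma length_flip [simp]: "length (flip x A) = length x"
  by (simp add: flip_def)

lemma nth_flip [simp]: "i < length x \<Longrightarrow> flip x A ! i = (x ! i \<noteq> (i \<in> A))"
  by (simp add: flip_def)

lemma flip_empty [simp]: "flip x {} = x"
  by (rule nth_equalityI) auto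

lemma flip_flip [simp]: "flip (flip x A) B = flip x (sym_diff A B)"
  by (rule nth_equalityI) auto

lemma flip_eq_iff: "A \<subseteq> {..<length x} \<Longrightarrow> B \<subseteq> {..<length x} \<Longrightarrow> flip x A = flip x B \<longleftrightarrow> A = B"
  by (auto simp: list_eq_iff_nth_eq)

lemma flip_surj:
  assumes "length u = length v" obtains A where "A \<subseteq> {..<length u}" "v = flip u A"
proof
  show "{i. i < length u \<and> u ! i \<noteq> v ! i} \<subseteq> {..<length u}" by auto
  show "v = flip u {i. i < length u \<and> u ! i \<noteq> v ! i}"
    by (rule nth_equalityI) (use assms in auto)
qed

lemma verts_hypercube [simp]: "verts (hypercube n) = {u. length u = n}"
  by (simp add: hypercube_def)

lemma edge_hypercube_iff:
  "{u, v} \<in> edges (hypercube n) \<longleftrightarrow> length u = n \<and> (\<exists>i<n. v = flip u {i})"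
proof
  have *: "\<exists>i<n. v = flip u {i}"
    if uv: "length u = n" "length v = n" "card {i. i < n \<and> u ! i \<noteq> v ! i} = 1" for u v :: "bool list"
  proof -
    obtain i where i: "{i. i < n \<and> u ! i \<noteq> v ! i} = {i}"
      using uv(3) unfolding One_nat_def card_1_singleton_iff by blast
    then have "v = flip u {i}"
      by (intro nth_equalityI) (use uv in auto)
    then show ?thesis using i by blast
  qed
  assume "{u, v} \<in> edges (hypercube n)"
  then obtain a b where ab: "{u, v} = {a, b}" "length a = n" "length b = n"
    "card {i. i < n \<and> a ! i \<noteq> b ! i} = 1" by (auto simp: hypercube_def)
  have "{i. i < n \<and> b ! i \<noteq> a ! i} = {i. i < n \<and> a ! i \<noteq> b ! i}" by auto
  then have "length u = n" "length v = n" "card {i. i < n \<and> u ! i \<noteq> v ! i} = 1"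
    using ab unfolding doubleton_eq_iff by metis+
  then show "length u = n \<and> (\<exists>i<n. v = flip u {i})"
    using * by blast
next
  assume "length u = n \<and> (\<exists>i<n. v = flip u {i})"
  then obtain i where i: "length u = n" "i < n" "v = flip u {i}" by blast
  then have "{j. j < n \<and> u ! j \<noteq> v ! j} = {i}" by auto
  then have "card {j. j < n \<and> u ! j \<noteq> v ! j} = 1" by simp
  then show "{u, v} \<in> edges (hypercube n)"
    using i unfolding hypercube_def snd_conv mem_Collect_eq by (metis length_flip)
qed

lemma edge_hypercubeE:
  assumes "e \<in> edges (hypercube n)" "u \<in> e"
  obtains i where "e = {u, flip u {i}}" "i < n" "length u = n"
proof -
  obtain a b where "e = {a, b}" using assms by (auto simp: hypercube_def)
  then obtain v where "e = {u, v}" using assms by auto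
  then show ?thesis using that assms edge_hypercube_iff by metis
qed

lemma cop_move_shared: "\<lbrakk>e' \<in> edges G; v \<in> e; v \<in> e'\<rbrakk> \<Longrightarrow> cop_move G e e'"
  by (auto simp: cop_move_def)

section \<open>Tournaments and pairs of coordinates\<close>

text \<open>Orient each pair from its smaller to its larger element, but reverse the pair of minimum
  and maximum. The maximum is then a tail, the elements in between are tails towards the maximum,
  and the minimum is one towards any of these.\<close>

lemma ex_sinkless_tournament:
  fixes S :: "'a :: linorder set"
  assumes "finite S" "card S \<ge> 3"
  obtains tail where "\<And>p. p \<subseteq> S \<Longrightarrow> card p = 2 \<Longrightarrow> tail p \<in> p"
    and "\<And>j. j \<in> S \<Longrightarrow> \<exists>p \<subseteq> S. card p = 2 \<and> tail p = j"
proof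
  let ?tail = "\<lambda>p. if p = {Min S, Max S} then Max S else Min p"
  have ne: "S \<noteq> {}" using assms by auto
  show "?tail p \<in> p" if "p \<subseteq> S" "card p = 2" for p
  proof -
    have "finite p" "p \<noteq> {}" using that(2) card.infinite by fastforce+
    then show ?thesis using Min_in[of p] by auto
  qed
  fix j assume j: "j \<in> S"
  have mm: "Min S \<in> S" "Max S \<in> S" using ne assms by auto
  have "\<not> S \<subseteq> {Min S, Max S}"
    using assms(2) card_mono[of "{Min S, Max S}" S] card_insert_le_m1[of 2 "{Max S}" "Min S"] by auto
  then obtain m where m: "m \<in> S" "m \<noteq> Min S" "m \<noteq> Max S" by blast
  have lt: "Min S < m" "m < Max S"
    using m Min_le[OF assms(1) m(1)] Max_ge[OF assms(1) m(1)] by auto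
  consider "j = Max S" | "j = Min S" | "Min S < j" "j < Max S"
    using Min_le[OF assms(1) j] Max_ge[OF assms(1) j] by fastforce
  then show "\<exists>p \<subseteq> S. card p = 2 \<and> ?tail p = j"
  proof cases
    case 1
    then show ?thesis using mm lt by (intro exI[of _ "{Min S, Max S}"]) auto
  next
    case 2
    then show ?thesis using mm m lt by (intro exI[of _ "{Min S, m}"]) (auto simp: doubleton_eq_iff)
  next
    case 3
    then show ?thesis using mm j by (intro exI[of _ "{j, Max S}"]) (auto simp: doubleton_eq_iff)
  qed
qed

definition pairs :: "nat \<Rightarrow> nat set set" where
  "pairs n = {p. p \<subseteq> {..<n} \<and> card p = 2}"

lemma finite_pairs [simp]: "finite (pairs n)"
  by (simp add: pairs_def)

lemma card_pairs: "card (pairs n) = n choose 2"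
  using n_subsets[of "{..<n}" 2] by (simp add: pairs_def)

lemma pair_in_pairs [simp]: "{i, j} \<in> pairs n \<longleftrightarrow> i < n \<and> j < n \<and> i \<noteq> j"
  by (auto simp: pairs_def card_2_iff doubleton_eq_iff)

lemma pairsE:
  assumes "p \<in> pairs n" "i \<in> p"
  obtains j where "p = {i, j}" "i \<noteq> j" "i < n" "j < n"
  using assms by (auto simp: pairs_def card_2_iff)

lemma pair_edge:
  assumes "p \<in> pairs n" "i \<in> p" "length x = n"
  shows "{flip x {i}, flip x p} \<in> edges (hypercube n)"
proof -
  obtain j where "p = {i, j}" "i \<noteq> j" "j < n" using pairsE[OF assms(1,2)] .
  then show ?thesis using assms by (auto simp: edge_hypercube_iff intro!: exI[of _ j] arg_cong[of _ _ "flip x"])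
qed

lemma unit_edge: "i < n \<Longrightarrow> length x = n \<Longrightarrow> {x, flip x {i}} \<in> edges (hypercube n)"
  by (auto simp: edge_hypercube_iff)

section \<open>The endgame around a fixed vertex\<close>

lemma wins_within_if_surrounded:
  assumes "\<And>j. j < n \<Longrightarrow> {x, flip x {j}} \<in> c ` P"
  shows "wins_within (hypercube n) P 0 c x"
  using assms by (auto elim!: edge_hypercubeE)

text \<open>The robber stands on \<open>flip x {i}\<close>, and only his edge to \<open>x\<close>
  can be open. The trapping cops keep \<open>flip x p\<close> as an end, so they remain in place
  relative to \<open>x\<close>.\<close>

definition trapped :: "nat \<Rightarrow> (nat set \<Rightarrow> bool list set) \<Rightarrow> bool list \<Rightarrow> nat \<Rightarrow> bool" where
  "trapped n c x i \<longleftrightarrow> i < n \<and> (\<forall>p \<in> pairs n. i \<in> p \<longrightarrow> c p = {flip x {i}, flip x p})"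

lemma flip_nbr:
  assumes "i \<noteq> j" shows "flip (flip x {i}) {j} = flip x {i, j}"
  using assms by (simp add: insert_Diff_if) (metis insert_commute insert_is_Un)

lemma trapped_robber_move:
  assumes "trapped n c x i" "y = flip x {i} \<or> {flip x {i}, y} \<in> edges (hypercube n) - c ` pairs n"
  shows "y = flip x {i} \<or> y = x"
proof (rule ccontr)
  assume not: "\<not> ?thesis"
  then obtain j where j: "j < n" "y = flip (flip x {i}) {j}"
    using assms(2) by (auto simp: edge_hypercube_iff)
  then have "j \<noteq> i" using not by auto
  then have "y = flip x {i, j}" "{i, j} \<in> pairs n"
    using j assms(1) by (auto simp only: flip_nbr pair_in_pairs trapped_def)
  then have "c {i, j} = {flip x {i}, y}" "c {i, j} \<in> c ` pairs n"
    using assms(1) unfolding trapped_def by blast+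
  then show False using assms(2) not by auto
qed

lemma trapped_edge:
  assumes "trapped n c x i" "length x = n" "j < n" "j \<noteq> i"
  shows "{flip x {i}, flip (flip x {i}) {j}} = c {i, j}"
proof -
  have "{i, j} \<in> pairs n" using assms by (auto simp: trapped_def)
  then show ?thesis
    using assms(1) unfolding flip_nbr[OF assms(4)[symmetric]] trapped_def by blast
qed

text \<open>At both ends of the edge between \<open>x\<close> and \<open>flip x {i}\<close> all
  other edges are blocked, by disjoint groups of cops. Whichever end the robber chooses, a cop
  guarding the other end steps onto this edge and completes the containment.\<close>

lemma wins_final:
  assumes n: "n \<ge> 4" and x: "length x = n" and t: "trapped n c x i"
    and cE: "\<forall>p \<in> pairs n. c p \<in> edges (hypercube n)"
    and guard: "\<And>j. j < n \<Longrightarrow> j \<noteq> i \<Longrightarrow> \<exists>p \<in> pairs n. i \<notin> p \<and> c p = {x, flip x {j}}"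
  shows "wins_within (hypercube n) (pairs n) 1 c (flip x {i})"
proof -
  have i: "i < n" using t by (simp add: trapped_def)
  obtain k where k: "k < n" "k \<noteq> i" using n by (intro that[of "if i = 0 then 1 else 0"]) auto
  have upd: "cop_moves (hypercube n) (pairs n) c (c(p := {x, flip x {i}}))"
    if "v \<in> c p" "v \<in> {x, flip x {i}}" for p v
    using cE that unit_edge[OF i x] by (auto simp: cop_moves_def cop_move_def)
  have "\<exists>c'. cop_moves (hypercube n) (pairs n) c c' \<and> wins_within (hypercube n) (pairs n) 0 c' y"
    if y: "y = flip x {i} \<or> y = x" for y
  proof (cases "y = x")
    case True
    let ?q = "{i, k}"
    have q: "?q \<in> pairs n" using i k by simp
    then have "flip x {i} \<in> c ?q" using t by (auto simp: trapped_def)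
    then have "cop_moves (hypercube n) (pairs n) c (c(?q := {x, flip x {i}}))" using upd by blast
    moreover have "wins_within (hypercube n) (pairs n) 0 (c(?q := {x, flip x {i}})) x"
    proof (rule wins_within_if_surrounded)
      fix j assume j: "j < n"
      show "{x, flip x {j}} \<in> (c(?q := {x, flip x {i}})) ` pairs n"
      proof (cases "j = i")
        case True then show ?thesis using q by (intro image_eqI[of _ _ ?q]) auto
      next
        case False
        then obtain p where "p \<in> pairs n" "i \<notin> p" "c p = {x, flip x {j}}" using guard j by blast
        then show ?thesis by (intro image_eqI[of _ _ p]) auto
      qed
    qed
    ultimately show ?thesis using True by blast
  next
    case False
    obtain q where q: "q \<in> pairs n" "i \<notin> q" "c q = {x, flip x {k}}" using guard k by blast
    then have "cop_moves (hypercube n) (pairs n) c (c(q := {x, flip x {i}}))" using upd by blast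
    moreover have "wins_within (hypercube n) (pairs n) 0 (c(q := {x, flip x {i}})) (flip x {i})"
    proof (rule wins_within_if_surrounded)
      fix j assume j: "j < n"
      show "{flip x {i}, flip (flip x {i}) {j}} \<in> (c(q := {x, flip x {i}})) ` pairs n"
      proof (cases "j = i")
        case True then show ?thesis using q by (intro image_eqI[of _ _ q]) auto
      next
        case False
        have "{flip x {i}, flip (flip x {i}) {j}} = c {i, j}" using trapped_edge[OF t x j False] .
        then show ?thesis using i j False q by (intro image_eqI[of _ _ "{i, j}"]) auto
      qed
    qed
    ultimately show ?thesis using y False by blast
  qed
  from wins_within_step[OF One_nat_def this[OF trapped_robber_move[OF t]]] show ?thesis .
qed

text \<open>The cops outside the trap turn about \<open>flip x {tail p}\<close> towards
  \<open>x\<close> and cover every direction there except \<open>i\<close>. If the robber has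
  returned to \<open>x\<close>, the trapping cops cover \<open>i\<close>; if not, they hold and
  \<open>wins_final\<close> applies.\<close>

lemma wins_trapped_oriented:
  assumes n: "n \<ge> 4" and x: "length x = n" and t: "trapped n c x i"
    and tail: "\<And>p. p \<in> pairs n \<Longrightarrow> i \<notin> p \<Longrightarrow> tail p \<in> p \<and> c p = {flip x {tail p}, flip x p}"
    and sinkless: "\<And>j. j < n \<Longrightarrow> j \<noteq> i \<Longrightarrow> \<exists>p \<in> pairs n. i \<notin> p \<and> tail p = j"
  shows "wins_within (hypercube n) (pairs n) 2 c (flip x {i})"
proof -
  have i: "i < n" using t by (simp add: trapped_def)
  have tn: "tail p < n" if "p \<in> pairs n" "i \<notin> p" for p
    using tail[OF that] that by (auto simp: pairs_def)
  have cE: "c p \<in> edges (hypercube n)" if "p \<in> pairs n" for p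
    using that t tail pair_edge[OF that _ x] by (cases "i \<in> p") (auto simp: trapped_def)
  have "\<exists>c'. cop_moves (hypercube n) (pairs n) c c' \<and> wins_within (hypercube n) (pairs n) 1 c' y"
    if y: "y = flip x {i} \<or> y = x" for y
  proof (cases "y = x")
    case True
    let ?c = "\<lambda>p. {x, flip x {if i \<in> p then i else tail p}}"
    have "cop_moves (hypercube n) (pairs n) c ?c"
      unfolding cop_moves_def
    proof
      fix p assume p: "p \<in> pairs n"
      show "cop_move (hypercube n) (c p) (?c p)"
        by (rule cop_move_shared[of _ _ "flip x {if i \<in> p then i else tail p}"])
          (use p i x tn tail t in \<open>auto simp: trapped_def intro: unit_edge\<close>)
    qed
    moreover have "wins_within (hypercube n) (pairs n) 0 ?c x"
    proof (rule wins_within_if_surrounded)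
      fix j assume j: "j < n"
      obtain k where k: "k < n" "k \<noteq> i" using n by (intro that[of "if i = 0 then 1 else 0"]) auto
      show "{x, flip x {j}} \<in> ?c ` pairs n"
      proof (cases "j = i")
        case True then show ?thesis using i k by (intro image_eqI[of _ _ "{i, k}"]) auto
      next
        case False
        then obtain p where "p \<in> pairs n" "i \<notin> p" "tail p = j" using sinkless j by blast
        then show ?thesis by (intro image_eqI[of _ _ p]) auto
      qed
    qed
    ultimately show ?thesis unfolding True by (meson wins_within_mono zero_le)
  next
    case False
    let ?c = "\<lambda>p. if i \<in> p then c p else {x, flip x {tail p}}"
    have "cop_move (hypercube n) (c p) (?c p)" if p: "p \<in> pairs n" for p
      by (rule cop_move_shared[of _ _ "flip x {if i \<in> p then i else tail p}"])
        (use p x tn tail t cE[OF p] in \<open>auto simp: trapped_def intro: unit_edge\<close>)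
    then have m: "cop_moves (hypercube n) (pairs n) c ?c" by (simp add: cop_moves_def)
    have "wins_within (hypercube n) (pairs n) 1 ?c (flip x {i})"
    proof (rule wins_final[OF n x])
      show "trapped n ?c x i" using t by (simp add: trapped_def)
      show "\<forall>p \<in> pairs n. ?c p \<in> edges (hypercube n)" using m by (auto simp: cop_moves_def cop_move_def)
      show "\<exists>p \<in> pairs n. i \<notin> p \<and> ?c p = {x, flip x {j}}" if "j < n" "j \<noteq> i" for j
        using sinkless[OF that] by auto
    qed
    then show ?thesis using m y False by blast
  qed
  from wins_within_step[OF Suc_1[symmetric] this[OF trapped_robber_move[OF t]]] show ?thesis .
qed

text \<open>With \<open>flip x p\<close> on her edge, a cop can turn towards
  \<open>flip x {j}\<close> for either \<open>j \<in> p\<close>. She takes \<open>j = i\<close> if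
  possible, and the tail of \<open>p\<close> otherwise.\<close>

lemma go_trapped_oriented:
  assumes n: "n \<ge> 4" and x: "length x = n" and i: "i < n"
    and at: "\<And>p. p \<in> pairs n \<Longrightarrow> flip x p \<in> c p"
  shows "\<exists>c'. cop_moves (hypercube n) (pairs n) c c' \<and> wins_within (hypercube n) (pairs n) 2 c' (flip x {i})"
proof -
  \<comment> \<open>A sinkless tournament on the coordinates other than \<open>i\<close> needs three
    of them; here \<open>n \<ge> 4\<close> matters.\<close>
  have "card ({..<n} - {i}) \<ge> 3" using n i by simp
  then obtain tail where tail: "\<And>p. p \<subseteq> {..<n} - {i} \<Longrightarrow> card p = 2 \<Longrightarrow> tail p \<in> p"
    "\<And>j. j \<in> {..<n} - {i} \<Longrightarrow> \<exists>p \<subseteq> {..<n} - {i}. card p = 2 \<and> tail p = j"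
    using ex_sinkless_tournament[of "{..<n} - {i}"] by blast
  have tail': "tail p \<in> p" if "p \<in> pairs n" "i \<notin> p" for p
    using that tail(1) by (auto simp: pairs_def)
  let ?c = "\<lambda>p. {flip x {if i \<in> p then i else tail p}, flip x p}"
  have "cop_move (hypercube n) (c p) (?c p)" if p: "p \<in> pairs n" for p
    by (rule cop_move_shared[of _ _ "flip x p"]) (use p tail' at x in \<open>auto intro: pair_edge\<close>)
  then have "cop_moves (hypercube n) (pairs n) c ?c" by (simp add: cop_moves_def)
  moreover have "wins_within (hypercube n) (pairs n) 2 ?c (flip x {i})"
  proof (rule wins_trapped_oriented[OF n x])
    show "trapped n ?c x i" using i by (simp add: trapped_def)
    show "tail p \<in> p \<and> ?c p = {flip x {tail p}, flip x p}" if "p \<in> pairs n" "i \<notin> p" for p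
      using that tail' by simp
    fix j assume "j < n" "j \<noteq> i"
    then obtain p where "p \<subseteq> {..<n} - {i}" "card p = 2" "tail p = j" using tail(2)[of j] by auto
    then show "\<exists>p \<in> pairs n. i \<notin> p \<and> tail p = j" by (auto simp: pairs_def)
  qed
  ultimately show ?thesis by (intro exI[of _ ?c] conjI)
qed

text \<open>If the robber stays, all cops turn to \<open>x\<close> and cover every direction, as
  each is a tail. If he moves, the ends \<open>flip x p\<close> are still held, so a new orientation
  that leaves out his direction can be chosen.\<close>

lemma wins_oriented:
  assumes n: "n \<ge> 4" and x: "length x = n"
    and tail: "\<And>p. p \<in> pairs n \<Longrightarrow> tail p \<in> p \<and> c p = {flip x {tail p}, flip x p}"
    and sinkless: "\<And>j. j < n \<Longrightarrow> \<exists>p \<in> pairs n. tail p = j"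
  shows "wins_within (hypercube n) (pairs n) 3 c x"
proof -
  let ?c = "\<lambda>p. {x, flip x {tail p}}"
  have "cop_move (hypercube n) (c p) (?c p)" if p: "p \<in> pairs n" for p
    by (rule cop_move_shared[of _ _ "flip x {tail p}"])
      (use p x tail[OF p] in \<open>auto simp: pairs_def intro: unit_edge\<close>)
  then have "cop_moves (hypercube n) (pairs n) c ?c" by (simp add: cop_moves_def)
  moreover have "wins_within (hypercube n) (pairs n) 2 ?c x"
    by (rule wins_within_mono[OF _ wins_within_if_surrounded]) (use sinkless in auto)
  ultimately have stay: "\<exists>c'. cop_moves (hypercube n) (pairs n) c c' \<and> wins_within (hypercube n) (pairs n) 2 c' x"
    by (intro exI[of _ ?c] conjI)
  have go: "\<exists>c'. cop_moves (hypercube n) (pairs n) c c' \<and> wins_within (hypercube n) (pairs n) 2 c' (flip x {i})"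
    if "i < n" for i
    by (rule go_trapped_oriented[OF n x that]) (simp add: tail)
  show ?thesis
  proof (rule wins_within_step[where m = 2])
    fix y assume "y = x \<or> {x, y} \<in> edges (hypercube n) - c ` pairs n"
    then consider "y = x" | i where "i < n" "y = flip x {i}" by (auto simp: edge_hypercube_iff)
    then show "\<exists>c'. cop_moves (hypercube n) (pairs n) c c' \<and> wins_within (hypercube n) (pairs n) 2 c' y"
      using stay go by cases simp_all
  qed simp
qed

text \<open>Both positions of the robber are treated alike: when trapped he can only stay or return
  to \<open>x\<close>, so \<open>x\<close> remains the reference vertex.\<close>

lemma wins_all_on_target:
  assumes n: "n \<ge> 4" and x: "length x = n" and at: "\<And>p. p \<in> pairs n \<Longrightarrow> flip x p \<in> c p"
    and r: "r = x \<or> (\<exists>i. r = flip x {i} \<and> trapped n c x i)"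
  shows "wins_within (hypercube n) (pairs n) 4 c r"
proof -
  have "card {..<n} \<ge> 3" using n by simp
  then obtain tail where tail: "\<And>p. p \<subseteq> {..<n} \<Longrightarrow> card p = 2 \<Longrightarrow> tail p \<in> p"
    "\<And>j. j \<in> {..<n} \<Longrightarrow> \<exists>p \<subseteq> {..<n}. card p = 2 \<and> tail p = j"
    using ex_sinkless_tournament[OF finite_lessThan] by blast
  let ?c = "\<lambda>p. {flip x {tail p}, flip x p}"
  have "cop_move (hypercube n) (c p) (?c p)" if p: "p \<in> pairs n" for p
    by (rule cop_move_shared[of _ _ "flip x p"])
      (use p tail(1) at x in \<open>auto simp: pairs_def intro!: pair_edge\<close>)
  then have "cop_moves (hypercube n) (pairs n) c ?c" by (simp add: cop_moves_def)
  moreover have "wins_within (hypercube n) (pairs n) 3 ?c x"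
    by (rule wins_oriented[OF n x]) (use tail in \<open>auto simp: pairs_def\<close>)
  ultimately have stay: "\<exists>c'. cop_moves (hypercube n) (pairs n) c c' \<and> wins_within (hypercube n) (pairs n) 3 c' x"
    by (intro exI[of _ ?c] conjI)
  have go: "\<exists>c'. cop_moves (hypercube n) (pairs n) c c' \<and> wins_within (hypercube n) (pairs n) 3 c' (flip x {i})"
    if i: "i < n" for i
  proof -
    obtain c' where "cop_moves (hypercube n) (pairs n) c c'" "wins_within (hypercube n) (pairs n) 2 c' (flip x {i})"
      using go_trapped_oriented[OF n x i at] by blast
    then show ?thesis by (intro exI[of _ c'] conjI) (auto intro: wins_within_mono[of 2 3])
  qed
  have "\<exists>c'. cop_moves (hypercube n) (pairs n) c c' \<and> wins_within (hypercube n) (pairs n) 3 c' y"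
    if y: "y = r \<or> {r, y} \<in> edges (hypercube n) - c ` pairs n" for y
    using r
  proof
    assume "r = x"
    then consider "y = x" | i where "i < n" "y = flip x {i}" using y by (auto simp: edge_hypercube_iff)
    then show ?thesis using stay go by cases simp_all
  next
    assume "\<exists>i. r = flip x {i} \<and> trapped n c x i"
    then obtain i where i: "r = flip x {i}" "trapped n c x i" by blast
    then have "y = flip x {i} \<or> y = x" "i < n"
      using trapped_robber_move[OF i(2)] y by (auto simp: trapped_def)
    then show ?thesis using stay go by auto
  qed
  then show ?thesis
    by (intro wins_within_step[where m = 3]) simp_all
qed

section \<open>The potential function and the pursuit\<close>

text \<open>The distance of a cop's offset \<open>D\<close> from the pair \<open>p\<close> assigned to her. An excess coordinate
  costs more than the two missing ones together, so that removing one pays even if the robber's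
  own move disturbs \<open>D \<inter> p\<close>.\<close>

definition gap :: "nat set \<Rightarrow> nat set \<Rightarrow> nat" where
  "gap p D = 3 * card (D - p) + card (p - D)"

lemma gap_eq_0_iff: "finite p \<Longrightarrow> finite D \<Longrightarrow> gap p D = 0 \<longleftrightarrow> D = p"
  by (auto simp: gap_def)

lemma gap_decrease_stay:
  assumes "p \<in> pairs n" "D \<subseteq> {..<n}" "D \<noteq> p"
  obtains k where "k < n" "gap p (sym_diff D {k}) < gap p D"
proof (cases "D - p = {}")
  case False
  have fin: "finite D" "finite p" using assms finite_subset by (auto simp: pairs_def)
  obtain k where k: "k \<in> D - p" using False by blast
  have "sym_diff D {k} - p = D - p - {k}" "p - sym_diff D {k} = p - D" using k by auto
  moreover have "card (D - p - {k}) < card (D - p)" by (rule card_Diff1_less) (use fin k in auto)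
  ultimately have "gap p (sym_diff D {k}) < gap p D" unfolding gap_def by (metis add_less_mono1 mult_less_mono2 zero_less_numeral)
  then show ?thesis using that[of k] k assms by blast
next
  case True
  have fin: "finite D" "finite p" using assms finite_subset by (auto simp: pairs_def)
  obtain k where k: "k \<in> p - D" using True assms by auto
  have "sym_diff D {k} - p = D - p" "p - sym_diff D {k} = p - D - {k}" using k by auto
  moreover have "card (p - D - {k}) < card (p - D)" by (rule card_Diff1_less) (use fin k in auto)
  ultimately have "gap p (sym_diff D {k}) < gap p D" unfolding gap_def by (metis add_less_cancel_left)
  moreover have "k < n" using k assms by (auto simp: pairs_def)
  ultimately show ?thesis using that[of k] by blast
qed

text \<open>If the robber moves in direction \<open>i\<close> and the cop's vertex stays, her offset
  becomes \<open>sym_diff D {i}\<close>. Removing an excess coordinate gains 3, while at most 2 are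
  missing afterwards. Without excess, \<open>i\<close> is missing and the robber's own move supplies
  it. If \<open>D = {i}\<close>, he steps onto her vertex and no reply lowers the gap; that case
  leads to the trap instead.\<close>

lemma gap_decrease_move:
  assumes "p \<in> pairs n" "D \<subseteq> {..<n}" "D \<noteq> p" "D \<noteq> {i}" "i \<in> p"
  obtains D' where "D' = sym_diff D {i} \<or> (\<exists>k<n. D' = sym_diff (sym_diff D {i}) {k})"
    "gap p D' < gap p D"
proof (cases "D - p = {}")
  case False
  have fin: "finite D" "finite p" using assms finite_subset by (auto simp: pairs_def)
  obtain k where k: "k \<in> D - p" using False by blast
  let ?D = "sym_diff (sym_diff D {i}) {k}"
  have "?D - p = D - p - {k}" using k assms(5) by auto
  moreover have "card (D - p - {k}) < card (D - p)" by (rule card_Diff1_less) (use fin k in auto)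
  moreover have "card (p - ?D) \<le> 2" using card_mono[of p "p - ?D"] fin assms(1) by (auto simp: pairs_def)
  ultimately have "gap p ?D < gap p D" by (simp add: gap_def)
  moreover have "k < n" using k assms by blast
  ultimately show ?thesis using that[of ?D] by blast
next
  case True
  have fin: "finite D" "finite p" using assms finite_subset by (auto simp: pairs_def)
  obtain j where j: "p = {i, j}" using pairsE[OF assms(1,5)] by metis
  then have k: "i \<in> p - D" using True assms by auto
  have "sym_diff D {i} - p = D - p" "p - sym_diff D {i} = p - D - {i}" using k by auto
  moreover have "card (p - D - {i}) < card (p - D)" by (rule card_Diff1_less) (use fin k in auto)
  ultimately have "gap p (sym_diff D {i}) < gap p D" unfolding gap_def by (metis add_less_cancel_left)
  then show ?thesis using that by blast
qed

text \<open>One end of each cop's edge is tracked by its offset from \<open>x\<close>. This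
  \<open>x\<close> is the robber's vertex or, when he is trapped, the other end of his edge left
  open.\<close>

definition offsets :: "nat \<Rightarrow> (nat set \<Rightarrow> bool list set) \<Rightarrow> bool list \<Rightarrow> (nat set \<Rightarrow> nat set) \<Rightarrow> bool" where
  "offsets n c x D \<longleftrightarrow> length x = n \<and>
     (\<forall>p \<in> pairs n. D p \<subseteq> {..<n} \<and> c p \<in> edges (hypercube n) \<and> flip x (D p) \<in> c p)"

definition total_gap :: "nat \<Rightarrow> (nat set \<Rightarrow> nat set) \<Rightarrow> nat" where
  "total_gap n D = (\<Sum>p \<in> pairs n. gap p (D p))"

text \<open>The tracked end can travel like a cop on vertices: to go from \<open>u\<close> to
  \<open>v\<close>, the cop takes the edge \<open>{u, v}\<close>.\<close>

lemma token_move: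
  assumes e: "e \<in> edges (hypercube n)" and u: "u \<in> e" and v: "v = u \<or> (\<exists>k<n. v = flip u {k})"
  obtains e' where "e' \<in> edges (hypercube n)" "cop_move (hypercube n) e e'" "v \<in> e'"
proof -
  have "length u = n" using edge_hypercubeE[OF e u] by metis
  then have "v = u \<or> {u, v} \<in> edges (hypercube n)" using v unit_edge by blast
  then show ?thesis
    using that[of e] that[of "{u, v}"] e u by (auto simp: cop_move_def)
qed

text \<open>The reference vertex is kept, so nothing disturbs the offsets. The cops in
  \<open>K\<close> take the edges that trap the robber at \<open>w\<close>; each already holds an
  end of her new edge. The others, if off target, reduce their gaps.\<close>

lemma advance:
  assumes o: "offsets n c x D" and pos: "total_gap n D \<noteq> 0"
    and K: "\<And>p. p \<in> pairs n \<Longrightarrow> p \<in> K \<Longrightarrow> {w, flip x p} \<in> edges (hypercube n) \<and> (D p = p \<or> flip x (D p) = w)"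
  obtains c' D' where "cop_moves (hypercube n) (pairs n) c c'" "offsets n c' x D'"
    "\<And>p. p \<in> pairs n \<Longrightarrow> p \<in> K \<Longrightarrow> c' p = {w, flip x p} \<and> D' p = p" "total_gap n D' < total_gap n D"
proof -
  \<comment> \<open>Every positive gap has to drop strictly, so a single positive summand makes the
    total drop.\<close>
  define good where "good p e d \<longleftrightarrow> cop_move (hypercube n) (c p) e \<and> d \<subseteq> {..<n} \<and> flip x d \<in> e
    \<and> (p \<in> K \<longrightarrow> e = {w, flip x p} \<and> d = p) \<and> gap p d \<le> gap p (D p) \<and> (gap p (D p) \<noteq> 0 \<longrightarrow> gap p d < gap p (D p))" for p e d
  have x: "length x = n" using o by (simp add: offsets_def)
  have "\<exists>e d. good p e d" if p: "p \<in> pairs n" for p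
  proof -
    have D: "D p \<subseteq> {..<n}" "c p \<in> edges (hypercube n)" "flip x (D p) \<in> c p" and pn: "p \<subseteq> {..<n}"
      using o p by (auto simp: offsets_def pairs_def)
    have fin: "finite p" "finite (D p)" using D pn finite_subset by auto
    have 0: "gap p p = 0" by (simp add: gap_def)
    show ?thesis
    proof (cases "p \<in> K")
      case True
      then have "good p {w, flip x p} p"
        using K[OF p True] D pn 0 fin by (auto simp: good_def intro: cop_move_shared)
      then show ?thesis by blast
    next
      case False
      show ?thesis
      proof (cases "D p = p")
        case True
        then have "good p (c p) p" using False D 0 by (auto simp: good_def cop_move_def)
        then show ?thesis by blast
      next
        case neq: False
        obtain k where k: "k < n" "gap p (sym_diff (D p) {k}) < gap p (D p)"
          using gap_decrease_stay[OF p D(1) neq] .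
        obtain e where "cop_move (hypercube n) (c p) e" "flip (flip x (D p)) {k} \<in> e"
          using token_move[OF D(2,3), of "flip (flip x (D p)) {k}"] k by blast
        then have "good p e (sym_diff (D p) {k})"
          using False k D by (auto simp: good_def)
        then show ?thesis by blast
      qed
    qed
  qed
  then obtain c' D' where g: "\<And>p. p \<in> pairs n \<Longrightarrow> good p (c' p) (D' p)" by metis
  show ?thesis
  proof
    show "cop_moves (hypercube n) (pairs n) c c'" using g by (simp add: cop_moves_def good_def)
    show "offsets n c' x D'" using g x by (auto simp: offsets_def good_def cop_move_def)
    show "c' p = {w, flip x p} \<and> D' p = p" if "p \<in> pairs n" "p \<in> K" for p
      using g that by (simp add: good_def)
    show "total_gap n D' < total_gap n D"
      unfolding total_gap_def
    proof (rule sum_strict_mono_ex1)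
      show "\<forall>p \<in> pairs n. gap p (D' p) \<le> gap p (D p)" using g by (simp add: good_def)
      show "\<exists>p \<in> pairs n. gap p (D' p) < gap p (D p)"
        using pos g by (auto simp: total_gap_def good_def)
    qed simp
  qed
qed

text \<open>The reference vertex follows the robber. All cops but \<open>q\<close> mirror his move,
  which preserves their offsets, and \<open>q\<close> lowers her gap by
  \<open>gap_decrease_move\<close>.\<close>

lemma chase:
  assumes o: "offsets n c x D" and i: "i < n" and q: "q \<in> pairs n" "i \<in> q" "D q \<noteq> q" "D q \<noteq> {i}"
  obtains c' D' where "cop_moves (hypercube n) (pairs n) c c'" "offsets n c' (flip x {i}) D'"
    "total_gap n D' < total_gap n D"
proof -
  have x: "length x = n" using o by (simp add: offsets_def)
  have Dq: "D q \<subseteq> {..<n}" using o q by (simp add: offsets_def)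
  obtain d where d: "d = sym_diff (D q) {i} \<or> (\<exists>k<n. d = sym_diff (sym_diff (D q) {i}) {k})"
    "gap q d < gap q (D q)"
    using gap_decrease_move[OF q(1) Dq q(3,4,2)] .
  let ?D = "D(q := d)"
  have dn: "d \<subseteq> {..<n}" using d(1) Dq i by auto
  have "\<exists>e. cop_move (hypercube n) (c p) e \<and> flip (flip x {i}) (?D p) \<in> e" if p: "p \<in> pairs n" for p
  proof -
    have D: "c p \<in> edges (hypercube n)" "flip x (D p) \<in> c p"
      using o p by (auto simp: offsets_def)
    have eq: "flip x (D p) = flip (flip x {i}) (sym_diff (D p) {i})"
      unfolding flip_flip by (rule arg_cong[of _ _ "flip x"]) auto
    have "?D p = sym_diff (D p) {i} \<or> (\<exists>k<n. ?D p = sym_diff (sym_diff (D p) {i}) {k})"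
    proof (cases "p = q")
      case False
      have "D p = sym_diff (sym_diff (D p) {i}) {i}" by auto
      then show ?thesis using False i by (metis fun_upd_other)
    qed (use d(1) in simp)
    then have "flip (flip x {i}) (?D p) = flip x (D p) \<or>
        (\<exists>k<n. flip (flip x {i}) (?D p) = flip (flip x (D p)) {k})"
      unfolding eq by (metis flip_flip)
    then show ?thesis using token_move[OF D] by blast
  qed
  then obtain c' where c': "\<And>p. p \<in> pairs n \<Longrightarrow> cop_move (hypercube n) (c p) (c' p) \<and> flip (flip x {i}) (?D p) \<in> c' p"
    by metis
  show ?thesis
  proof
    show "cop_moves (hypercube n) (pairs n) c c'" using c' by (simp add: cop_moves_def)
    show "offsets n c' (flip x {i}) ?D"
      using c' o dn x unfolding offsets_def by (auto simp: cop_move_def simp del: flip_flip)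
    show "total_gap n ?D < total_gap n D"
      unfolding total_gap_def
      by (rule sum_strict_mono_ex1) (use d(2) q in auto)
  qed
qed

text \<open>Each round lowers a positive total gap. When the robber moves in direction
  \<open>i\<close>, either \<open>chase\<close> applies to some pair containing \<open>i\<close>, or
  the cops of all these pairs trap him at once. At total gap 0 the last four rounds are those of
  \<open>wins_all_on_target\<close>.\<close>

lemma wins_pursuit:
  assumes n: "n \<ge> 4" and o: "offsets n c x D"
    and r: "r = x \<or> (\<exists>i. r = flip x {i} \<and> trapped n c x i \<and> (\<forall>p \<in> pairs n. i \<in> p \<longrightarrow> D p = p))"
  shows "wins_within (hypercube n) (pairs n) (total_gap n D + 4) c r"
  using o r
proof (induction "total_gap n D" arbitrary: c r x D rule: less_induct)
  case less
  note o = less.prems(1) and r = less.prems(2)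
  have x: "length x = n" using o by (simp add: offsets_def)
  show ?case
  proof (cases "total_gap n D = 0")
    case True
    have "D p = p" if p: "p \<in> pairs n" for p
    proof -
      have "finite p" "finite (D p)" "gap p (D p) = 0"
        using o p True finite_subset by (auto simp: offsets_def pairs_def total_gap_def)
      then show ?thesis by (simp add: gap_eq_0_iff)
    qed
    then have "flip x p \<in> c p" if p: "p \<in> pairs n" for p
      using o p by (metis offsets_def)
    then show ?thesis using wins_all_on_target[OF n x, of c r] r True by auto
  next
    case pos: False
    then obtain m where m: "total_gap n D + 4 = Suc m" "total_gap n D \<noteq> 0" by (metis add_eq_if add.commute)
    have IH: "wins_within (hypercube n) (pairs n) m c' r'"
      if "total_gap n D' < total_gap n D" "offsets n c' x' D'"
        "r' = x' \<or> (\<exists>i. r' = flip x' {i} \<and> trapped n c' x' i \<and> (\<forall>p \<in> pairs n. i \<in> p \<longrightarrow> D' p = p))"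
      for c' r' x' D'
      using less.hyps[OF that] wins_within_mono[of "total_gap n D' + 4" m] that(1) m by simp
    have stay: "\<exists>c'. cop_moves (hypercube n) (pairs n) c c' \<and> wins_within (hypercube n) (pairs n) m c' x"
    proof -
      obtain c' D' where "cop_moves (hypercube n) (pairs n) c c'" "offsets n c' x D'"
        "total_gap n D' < total_gap n D"
        using advance[OF o pos, of "{}"] by auto
      then show ?thesis using IH by blast
    qed
    \<comment> \<open>With offset \<open>p\<close> or \<open>{i}\<close> a cop holds an end of the
      edge from \<open>flip x {i}\<close> to \<open>flip x p\<close>, so one move springs the trap.
      The same step renews it while the robber stays there, the offsets then being
      \<open>p\<close>.\<close>
    have trap: "\<exists>c'. cop_moves (hypercube n) (pairs n) c c' \<and> wins_within (hypercube n) (pairs n) m c' (flip x {i})"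
      if i: "i < n" and ready: "\<forall>p \<in> pairs n. i \<in> p \<longrightarrow> D p = p \<or> D p = {i}" for i
    proof -
      have "{flip x {i}, flip x p} \<in> edges (hypercube n) \<and> (D p = p \<or> flip x (D p) = flip x {i})"
        if "p \<in> pairs n" "p \<in> {p. i \<in> p}" for p
        using that ready pair_edge[OF _ _ x] by auto
      then obtain c' D' where c': "cop_moves (hypercube n) (pairs n) c c'" "offsets n c' x D'"
        "\<And>p. p \<in> pairs n \<Longrightarrow> p \<in> {p. i \<in> p} \<Longrightarrow> c' p = {flip x {i}, flip x p} \<and> D' p = p"
        "total_gap n D' < total_gap n D"
        using advance[OF o pos, of "{p. i \<in> p}" "flip x {i}"] by metis
      then have "trapped n c' x i" using i by (simp add: trapped_def)
      then have "wins_within (hypercube n) (pairs n) m c' (flip x {i})"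
        using IH[OF c'(4,2)] c'(3) by blast
      then show ?thesis using c'(1) by blast
    qed
    have "\<exists>c'. cop_moves (hypercube n) (pairs n) c c' \<and> wins_within (hypercube n) (pairs n) m c' y"
      if y: "y = r \<or> {r, y} \<in> edges (hypercube n) - c ` pairs n" for y
      using r
    proof
      assume "r = x"
      show ?thesis
      proof (cases "y = x")
        case True then show ?thesis using stay by simp
      next
        case False
        then obtain i where i: "i < n" "y = flip x {i}"
          using y \<open>r = x\<close> by (auto simp: edge_hypercube_iff)
        show ?thesis
        proof (cases "\<forall>p \<in> pairs n. i \<in> p \<longrightarrow> D p = p \<or> D p = {i}")
          case True then show ?thesis using trap i by blast
        next
          case False
          then obtain q where "q \<in> pairs n" "i \<in> q" "D q \<noteq> q" "D q \<noteq> {i}" by blast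
          then obtain c' D' where "cop_moves (hypercube n) (pairs n) c c'" "offsets n c' (flip x {i}) D'"
            "total_gap n D' < total_gap n D"
            using chase[OF o i(1)] by metis
          then show ?thesis using IH i(2) by blast
        qed
      qed
    next
      assume "\<exists>i. r = flip x {i} \<and> trapped n c x i \<and> (\<forall>p \<in> pairs n. i \<in> p \<longrightarrow> D p = p)"
      then obtain i where i: "r = flip x {i}" "trapped n c x i" "\<forall>p \<in> pairs n. i \<in> p \<longrightarrow> D p = p" by blast
      then have "y = flip x {i} \<or> y = x" "i < n"
        using trapped_robber_move[OF i(2)] y by (auto simp: trapped_def)
      then show ?thesis using stay trap[of i] i(3) by auto
    qed
    then show ?thesis
      by (rule wins_within_step[OF m(1)])
  qed
qed

lemma hypercube_containable:
  assumes n: "n \<ge> 4"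
  shows "cop_containable (hypercube n) (n choose 2)"
proof -
  define u where "u = replicate n False"
  \<comment> \<open>All cops may start on one edge: with \<open>u = flip x A\<close>, each of them
    has the offset \<open>A\<close>.\<close>
  define c where "c = (\<lambda>p :: nat set. {u, flip u {0}})"
  have u: "length u = n" by (simp add: u_def)
  have e: "c p \<in> edges (hypercube n)" for p using unit_edge[of 0 n u] u n by (simp add: c_def)
  have "\<exists>c'. cop_moves (hypercube n) (pairs n) c c' \<and>
      wins_within (hypercube n) (pairs n) (card (pairs n) * (3 * n + 2) + 4) c' x"
    if x: "x \<in> verts (hypercube n)" for x
  proof -
    obtain A where A: "A \<subseteq> {..<n}" "u = flip x A"
      using flip_surj[of x u] x u by auto
    have "offsets n c x (\<lambda>_. A)" using A e x by (auto simp: offsets_def c_def)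
    then have win: "wins_within (hypercube n) (pairs n) (total_gap n (\<lambda>_. A) + 4) c x"
      using wins_pursuit[OF n] by blast
    \<comment> \<open>The number of rounds must be bounded independently of the robber's initial
      \<open>x\<close>. There are at most \<open>n\<close> excess coordinates and two missing
      ones.\<close>
    have "gap p A \<le> 3 * n + 2" if p: "p \<in> pairs n" for p
    proof -
      have "card (A - p) \<le> n" using card_mono[of "{..<n}" "A - p"] A by auto
      moreover have "card (p - A) \<le> 2"
        using card_mono[of p "p - A"] p finite_subset by (auto simp: pairs_def)
      ultimately show ?thesis by (simp add: gap_def)
    qed
    then have "total_gap n (\<lambda>_. A) \<le> card (pairs n) * (3 * n + 2)"
      unfolding total_gap_def using sum_bounded_above[of "pairs n" "\<lambda>p. gap p A" "3 * n + 2"] by simp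
    then have "wins_within (hypercube n) (pairs n) (card (pairs n) * (3 * n + 2) + 4) c x"
      using win wins_within_mono by (metis add_le_mono1)
    moreover have "cop_moves (hypercube n) (pairs n) c c" using e by (simp add: cop_moves_def cop_move_def)
    ultimately show ?thesis by blast
  qed
  from cop_containable_if_wins_within[OF finite_pairs e this] show ?thesis
    by (simp add: card_pairs)
qed

section \<open>The lower bound for the hypercube and the conclusion\<close>

lemma flip_singleton_eq_iff [simp]: "i < length x \<Longrightarrow> j < length x \<Longrightarrow> flip x {i} = flip x {j} \<longleftrightarrow> i = j"
  by (simp add: flip_eq_iff)

lemma nbrs_hypercube: "length x = n \<Longrightarrow> nbrs (hypercube n) x = (\<lambda>i. flip x {i}) ` {..<n}"
  by (auto simp: nbrs_def edge_hypercube_iff)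

text \<open>The colour is the parity of the number of ones. Distinct vertices with a common
  neighbour differ in exactly two coordinates, and every common neighbour arises by flipping one of
  these.\<close>

interpretation hypercube: regular_bipartite_codegree_two "hypercube n" n "\<lambda>x. even (card {i. i < n \<and> x ! i})"
proof
  show "finite_simple_graph (hypercube n)" by (rule finite_simple_graph_hypercube)
  show "card (nbrs (hypercube n) x) = n" if "x \<in> verts (hypercube n)" for x
    using that by (simp add: nbrs_hypercube card_image inj_on_def)
  show "even (card {i. i < n \<and> x ! i}) \<noteq> even (card {i. i < n \<and> y ! i})"
    if xy: "{x, y} \<in> edges (hypercube n)" for x y
  proof -
    obtain i where i: "length x = n" "i < n" "y = flip x {i}"
      using xy by (auto simp: edge_hypercube_iff)
    let ?S = "{j. j < n \<and> x ! j}"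
    have "{j. j < n \<and> y ! j} = (if x ! i then ?S - {i} else insert i ?S)"
      using i by auto
    moreover have "finite ?S" "x ! i \<Longrightarrow> card ?S \<noteq> 0" using i by auto
    ultimately show ?thesis using i by (auto simp: card_Diff_singleton_if)
  qed
  show "card (nbrs (hypercube n) x \<inter> nbrs (hypercube n) y) \<le> 2"
    if xy: "x \<in> verts (hypercube n)" "y \<in> verts (hypercube n)" "x \<noteq> y" for x y
  proof (cases "nbrs (hypercube n) x \<inter> nbrs (hypercube n) y = {}")
    case False
    have len: "length x = n" "length y = n" using xy by auto
    obtain i j where ij: "i < n" "j < n" "flip x {i} = flip y {j}"
      using False len by (auto simp: nbrs_hypercube)
    then have y: "y = flip (flip x {i}) {j}" by simp
    then have "i \<noteq> j" using xy by auto
    then have y: "y = flip x {i, j}" using y flip_nbr by metis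
    have "nbrs (hypercube n) x \<inter> nbrs (hypercube n) y \<subseteq> {flip x {i}, flip x {j}}"
    proof
      fix z assume "z \<in> nbrs (hypercube n) x \<inter> nbrs (hypercube n) y"
      then obtain k l where kl: "k < n" "l < n" "z = flip x {k}" "z = flip y {l}"
        using len by (auto simp: nbrs_hypercube)
      then have "flip x {k} = flip x (sym_diff {i, j} {l})" using y by (metis flip_flip)
      then have "{k} = sym_diff {i, j} {l}"
        using flip_eq_iff[of "{k}" x "sym_diff {i, j} {l}"] kl ij len by auto
      then have "k = i \<or> k = j" using \<open>i \<noteq> j\<close> by auto
      then show "z \<in> {flip x {i}, flip x {j}}" using kl by auto
    qed
    then have "card (nbrs (hypercube n) x \<inter> nbrs (hypercube n) y) \<le> card {flip x {i}, flip x {j}}"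
      by (rule card_mono[rotated]) simp
    also have "\<dots> \<le> 2" using card_insert_le_m1[of 2 "{flip x {j}}"] by simp
    finally show ?thesis .
  qed simp
qed

theorem theorem3p3:
  fixes n :: nat
  assumes "n \<ge> 4"
  shows "2 * n - 2 \<le> containability_number (hypercube n) \<and>
         containability_number (hypercube n) \<le> n choose 2"
proof
  have up: "cop_containable (hypercube n) (n choose 2)"
    using hypercube_containable[OF assms] .
  then have "cop_containable (hypercube n) (containability_number (hypercube n))"
    unfolding containability_number_def by (rule LeastI)
  then show "2 * n - 2 \<le> containability_number (hypercube n)"
    by (rule hypercube.containable_lower_bound[OF assms, rotated]) (auto intro: exI[of _ "replicate n False"])
  show "containability_number (hypercube n) \<le> n choose 2"
    unfolding containability_number_def using up by (rule Least_le)
qed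

end
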